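(* Let a finite extensive-form game with terminal histories $Z$, a strategy profile $\sigma$, a value function $v:Z\to\mathbb{R}$ and a heuristic value function $v'$ be given, and let $\hat v(z)$ denote the AIVAT estimate at $z\in Z$. Let $z_1,\dots,z_T$ be i.i.d. random terminal histories drawn according to $\sigma$, let $w_1,\dots,w_T$ be positive random (unnormalized) weights with finite expectations, and let $$\bar v^*=\frac{\sum_{t=1}^T w_t\,\hat v(z_t)}{\sum_{t=1}^T w_t}.$$ 1. If the weights $(w_1,\dots,w_T)$ are independent of the data being averaged over, $(\hat v(z_1),\dots,\hat v(z_T))$, then the weighted average is unbiased: $\mathbb{E}[\bar v^*\mid\sigma]=\mathbb{E}_{z\in Z}[v(z)\mid\sigma]$. 2. If the weights are correlated with the data being averaged over, the weighted average is in general biased: the equality $\mathbb{E}[\bar v^*\mid\sigma]=\mathbb{E}_{z\in Z}[v(z)\mid\sigma]$ need not hold, i.e. there exist a finite extensive-form game with terminal histories $Z$, a strategy profile $\sigma$, a value function $v:Z\to\mathbb{R}$, a heuristic value function $v'$, a number of trials $T$, i.i.d. random terminal histories $z_1,\dots,z_T$ drawn according to $\sigma$, and positive random weights $w_1,\dots,w_T$ with finite expectations that are correlated with the data $(\hat v(z_1),\dots,\hat v(z_T))$, for which $\mathbb{E}[\bar v^*\mid\sigma]\neq\mathbb{E}_{z\in Z}[v(z)\mid\sigma]$. 3. Assume that the data points, i.e. the pairs $(w_t,\hat v(z_t))$, $t=1,2,\dots$, are i.i.d., distributed as a pair of random variables $(w,\hat v(z))$. Then the asymptotic bias of $\bar v^*$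 is $\operatorname{Cov}(w,\hat v(z)\mid\sigma)/\mathbb{E}[w]$, i.e. $$\lim_{T\to\infty}\Big(\mathbb{E}[\bar v^*\mid\sigma]-\mathbb{E}_{z\in Z}[v(z)\mid\sigma]\Big)=\frac{\operatorname{Cov}(w,\hat v(z)\mid\sigma)}{\mathbb{E}[w]}.$$
   Context: An extensive-form game has a finite set of players (including chance $p_c$) and a finite set of histories $H$. Each non-terminal history $h$ has an acting player $p(h)$ and a set of available actions $A(h)$; $h\cdot a$ is the history obtained by applying $a\in A(h)$ at $h$. $Z\subseteq H$ is the set of terminal histories. For a strategy profile $\sigma$ (together with the fixed chance probabilities), $\pi(h)$ is the probability of reaching $h$, and $\mathbb{E}_{z\in Z}[v(z)\mid\sigma]=\sum_{z\in Z}\pi(z)v(z)$. $U(h)$ is the set of histories differing from $h$ only by the private information belonging to $p(h)$ (and $h\in U(h)$); $A(U(h))$ is the common set of actions available at the histories in $U(h)$. $K(z)$ is the set of histories $h\cdot a$ on the path to $z$ for which the probability distribution over actions at the immediate parent $h$ is known. Given a heuristic value function $v':H\to\mathbb{R}$, the AIVAT estimate at $z\in Z$ is $\hat v(z)=\hat v_b(z)+\hat v_c(z)$, where $$\hat v_b(z)=\frac{\sum_{z'\in U(z)}\pi(z')v(z')}{\sum_{z'\in U(z)}\pi(z')},$$ $$\hat v_c(z)=\sum_{h\cdot a\in K(z)}\left(\frac{\sum_{a'\in A(U(h))}\sum_{h'\in U(h)}\pi(h'\cdot a')v'(h'\cdot a')}{\sum_{h'\in U(h)}\pi(h')}-\frac{\sum_{h'\in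 U(h)}\pi(h'\cdot a)v'(h'\cdot a)}{\sum_{h'\in U(h)}\pi(h'\cdot a)}\right).$$ It is a known, previously established fact (which may be assumed) that the AIVAT estimate is unbiased for every choice of $v'$: $\mathbb{E}_{z\in Z}[\hat v(z)\mid\sigma]=\mathbb{E}_{z\in Z}[v(z)\mid\sigma]$. Conditioning on $\sigma$ means that all expectations and covariances are taken when play follows $\sigma$.
   Formalization: The formal version assumes that if the action distribution at h is known (as used in K(z)), it is known at every history in U(h), and that histories in U(h) share the acting player; without the former the AIVAT estimate can be biased. *)

theory Defs
  imports "HOL-Probability.Probability" "HOL-Library.Sublist"
begin

text \<open>
  Histories are finite sequences of actions, so \<open>h \<cdot> a\<close> is \<open>h @ [a]\<close>.
  \<open>public_info\<close> is what belongs to no player in particular; \<open>private_info q\<close> is what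
  belongs to player \<open>q\<close>.
\<close>

record ('p, 'a, 'i) efg =
  players :: "'p set"
  chance :: 'p
  histories :: "'a list set"
  player :: "'a list \<Rightarrow> 'p"
  chance_prob :: "'a list \<Rightarrow> 'a pmf"
  public_info :: "'a list \<Rightarrow> 'i"
  private_info :: "'p \<Rightarrow> 'a list \<Rightarrow> 'i"

definition actions :: "('p, 'a, 'i) efg \<Rightarrow> 'a list \<Rightarrow> 'a set" where
  "actions G h = {a. h @ [a] \<in> histories G}"

definition terminals :: "('p, 'a, 'i) efg \<Rightarrow> 'a list set" where
  "terminals G = {h \<in> histories G. actions G h = {}}"

definition nonterminals :: "('p, 'a, 'i) efg \<Rightarrow> 'a list set" where
  "nonterminals G = histories G - terminals G"

text \<open>The set \<open>U(h)\<close>.\<close>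

definition private_class :: "('p, 'a, 'i) efg \<Rightarrow> 'a list \<Rightarrow> 'a list set" where
  "private_class G h =
     {h' \<in> histories G. public_info G h' = public_info G h \<and>
        (\<forall>q \<in> players G - {player G h}. private_info G q h' = private_info G q h)}"

text \<open>What the acting player can tell about a history: the information set of \<open>h\<close>.\<close>

definition info_set :: "('p, 'a, 'i) efg \<Rightarrow> 'a list \<Rightarrow> 'a list set" where
  "info_set G h =
     {h' \<in> nonterminals G. player G h' = player G h \<and> public_info G h' = public_info G h \<and>
        private_info G (player G h) h' = private_info G (player G h) h}"

text \<open>
  The sets \<open>U(z)\<close> are also needed at terminal \<open>z\<close>, where nobody acts; there \<open>player G z\<close>
  is the player whose private information is averaged over.  By \<open>class_player\<close>
  the sets \<open>private_class G h\<close> partition the histories, and \<open>class_actions\<close> says that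
  \<open>A(U(h))\<close> is well defined (so that \<open>U(z)\<close> is a set of terminal histories).
\<close>

locale extensive_form_game =
  fixes G :: "('p, 'a, 'i) efg"
  assumes finite_players: "finite (players G)"
    and chance_player: "chance G \<in> players G"
    and finite_histories: "finite (histories G)"
    and root: "[] \<in> histories G"
    and prefix_closed: "h @ [a] \<in> histories G \<Longrightarrow> h \<in> histories G"
    and player_in: "h \<in> histories G \<Longrightarrow> player G h \<in> players G"
    and chance_support:
      "\<lbrakk>h \<in> nonterminals G; player G h = chance G\<rbrakk> \<Longrightarrow> set_pmf (chance_prob G h) \<subseteq> actions G h"
    and class_player:
      "\<lbrakk>h \<in> histories G; h' \<in> private_class G h\<rbrakk> \<Longrightarrow> player G h' = player G h"
    and class_actions:
      "\<lbrakk>h \<in> histories G; h' \<in> private_class G h\<rbrakk> \<Longrightarrow> actions G h' = actions G h"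
    and info_actions:
      "\<lbrakk>h \<in> nonterminals G; player G h \<noteq> chance G; h' \<in> info_set G h\<rbrakk>
        \<Longrightarrow> actions G h' = actions G h"

text \<open>
  A profile gives each player other than chance a behavioural strategy, which may
  depend only on the information set.
\<close>

definition strategy_profile :: "('p, 'a, 'i) efg \<Rightarrow> ('p \<Rightarrow> 'a list \<Rightarrow> 'a pmf) \<Rightarrow> bool" where
  "strategy_profile G \<sigma> \<longleftrightarrow>
     (\<forall>h \<in> nonterminals G. player G h \<noteq> chance G \<longrightarrow>
        set_pmf (\<sigma> (player G h) h) \<subseteq> actions G h \<and>
        (\<forall>h' \<in> info_set G h. \<sigma> (player G h) h' = \<sigma> (player G h) h))"

definition action_dist ::
  "('p, 'a, 'i) efg \<Rightarrow> ('p \<Rightarrow> 'a list \<Rightarrow> 'a pmf) \<Rightarrow> 'a list \<Rightarrow> 'a pmf" where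
  "action_dist G \<sigma> h =
     (if player G h = chance G then chance_prob G h else \<sigma> (player G h) h)"

text \<open>The reach probability \<open>\<pi>(h)\<close>.\<close>

definition reach ::
  "('p, 'a, 'i) efg \<Rightarrow> ('p \<Rightarrow> 'a list \<Rightarrow> 'a pmf) \<Rightarrow> 'a list \<Rightarrow> real" where
  "reach G \<sigma> h = (\<Prod>i<length h. pmf (action_dist G \<sigma> (take i h)) (h ! i))"

definition terminal_expectation ::
  "('p, 'a, 'i) efg \<Rightarrow> ('p \<Rightarrow> 'a list \<Rightarrow> 'a pmf) \<Rightarrow> ('a list \<Rightarrow> real) \<Rightarrow> real" where
  "terminal_expectation G \<sigma> f = (\<Sum>z\<in>terminals G. reach G \<sigma> z * f z)"

text \<open>
  The histories at which the distribution over actions is known to the evaluator.  The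
  correction term at \<open>h\<close> uses the distributions at all of \<open>U(h)\<close>, hence the closure condition
  (without it the estimate is biased in general).
\<close>

definition known_histories :: "('p, 'a, 'i) efg \<Rightarrow> 'a list set \<Rightarrow> bool" where
  "known_histories G D \<longleftrightarrow>
     D \<subseteq> nonterminals G \<and> (\<forall>h \<in> D. private_class G h \<subseteq> D)"

text \<open>The set \<open>K(z)\<close>, with \<open>h \<cdot> a\<close> given as the pair \<open>(h, a)\<close>.\<close>

definition known_steps :: "'a list set \<Rightarrow> 'a list \<Rightarrow> ('a list \<times> 'a) set" where
  "known_steps D z = {(h, a). prefix (h @ [a]) z \<and> h \<in> D}"

definition aivat_base ::
  "('p, 'a, 'i) efg \<Rightarrow> ('p \<Rightarrow> 'a list \<Rightarrow> 'a pmf) \<Rightarrow> ('a list \<Rightarrow> real) \<Rightarrow> 'a list \<Rightarrow> real" where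
  "aivat_base G \<sigma> v z =
     (\<Sum>z'\<in>private_class G z. reach G \<sigma> z' * v z') / (\<Sum>z'\<in>private_class G z. reach G \<sigma> z')"

definition aivat_correction ::
  "('p, 'a, 'i) efg \<Rightarrow> ('p \<Rightarrow> 'a list \<Rightarrow> 'a pmf) \<Rightarrow> 'a list set \<Rightarrow> ('a list \<Rightarrow> real)
    \<Rightarrow> 'a list \<Rightarrow> real" where
  "aivat_correction G \<sigma> D v' z =
     (\<Sum>(h, a)\<in>known_steps D z.
        (\<Sum>a'\<in>actions G h. \<Sum>h'\<in>private_class G h. reach G \<sigma> (h' @ [a']) * v' (h' @ [a']))
          / (\<Sum>h'\<in>private_class G h. reach G \<sigma> h')
        - (\<Sum>h'\<in>private_class G h. reach G \<sigma> (h' @ [a]) * v' (h' @ [a]))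
          / (\<Sum>h'\<in>private_class G h. reach G \<sigma> (h' @ [a])))"

definition aivat ::
  "('p, 'a, 'i) efg \<Rightarrow> ('p \<Rightarrow> 'a list \<Rightarrow> 'a pmf) \<Rightarrow> 'a list set \<Rightarrow> ('a list \<Rightarrow> real)
    \<Rightarrow> ('a list \<Rightarrow> real) \<Rightarrow> 'a list \<Rightarrow> real" where
  "aivat G \<sigma> D v v' z = aivat_base G \<sigma> v z + aivat_correction G \<sigma> D v' z"

definition random_terminal ::
  "'m measure \<Rightarrow> ('p, 'a, 'i) efg \<Rightarrow> ('p \<Rightarrow> 'a list \<Rightarrow> 'a pmf) \<Rightarrow> ('m \<Rightarrow> 'a list) \<Rightarrow> bool" where
  "random_terminal M G \<sigma> z \<longleftrightarrow>
     distributed M (count_space (terminals G)) z (\<lambda>\<zeta>. ennreal (reach G \<sigma> \<zeta>))"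

definition random_weight :: "'m measure \<Rightarrow> ('m \<Rightarrow> real) \<Rightarrow> bool" where
  "random_weight M w \<longleftrightarrow> integrable M w \<and> (AE x in M. 0 < w x)"

text \<open>No relation between the weights and the histories is imposed here.\<close>

definition weighted_trials ::
  "'m measure \<Rightarrow> ('p, 'a, 'i) efg \<Rightarrow> ('p \<Rightarrow> 'a list \<Rightarrow> 'a pmf) \<Rightarrow> nat set
    \<Rightarrow> (nat \<Rightarrow> 'm \<Rightarrow> 'a list) \<Rightarrow> (nat \<Rightarrow> 'm \<Rightarrow> real) \<Rightarrow> bool" where
  "weighted_trials M G \<sigma> I z w \<longleftrightarrow>
     prob_space M \<and>
     prob_space.indep_vars M (\<lambda>_. count_space (terminals G)) z I \<and>
     (\<forall>t\<in>I. random_terminal M G \<sigma> (z t)) \<and>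
     (\<forall>t\<in>I. random_weight M (w t))"

definition weighted_avg :: "nat \<Rightarrow> (nat \<Rightarrow> 'm \<Rightarrow> real) \<Rightarrow> (nat \<Rightarrow> 'm \<Rightarrow> real) \<Rightarrow> 'm \<Rightarrow> real" where
  "weighted_avg T w y x = (\<Sum>t=1..T. w t x * y t x) / (\<Sum>t=1..T. w t x)"

definition covariance :: "'m measure \<Rightarrow> ('m \<Rightarrow> real) \<Rightarrow> ('m \<Rightarrow> real) \<Rightarrow> real" where
  "covariance M X Y =
     (\<integral>x. (X x - (\<integral>x. X x \<partial>M)) * (Y x - (\<integral>x. Y x \<partial>M)) \<partial>M)"

end

theory Submission
  imports Defs
begin

text \<open>
  Within a class \<open>U(h)\<close>, replacing a quantity by its reach-weighted average over the class leaves its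
  reach-weighted sum unchanged.  Applied to the base term this gives the expectation of \<open>v\<close>, and applied to
  both halves of each correction term it shows that they have the same expectation, so the
  AIVAT estimate is unbiased.  Independent weights then enter only through the normalized weights
  \<open>w\<^sub>t / \<Sum>w\<^sub>s\<close>, which sum to 1.

  For the asymptotic bias, let \<open>m = E[w]\<close> and \<open>c = E[w y] / m\<close>, where \<open>y\<close> is the estimate, bounded by \<open>B\<close>.
  With \<open>W = \<Sum>w\<^sub>t\<close> and \<open>S = \<Sum>w\<^sub>t (y\<^sub>t - c)\<close>, the weighted average \<open>a\<close> satisfies
  \<open>(a - c) m = S / T - (a - c) (W / T - m)\<close> and \<open>\<bar>a - c\<bar> \<le> 2 B\<close>, so the weak law of large numbers
  in \<open>L\<^sup>1\<close>, applied to \<open>W\<close> and \<open>S\<close>, gives \<open>E[a] \<rightarrow> c\<close>.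
\<close>

section \<open>Unbiasedness of the AIVAT estimate\<close>

text \<open>After exchanging the two sums, each \<open>h'\<close> collects the total weight of its
  class divided by that same total. The hypotheses on \<open>C\<close> say that the sets
  \<open>C h\<close> partition \<open>A\<close>. Classes of total weight 0 are allowed.\<close>

lemma sum_class_average:
  fixes r x :: "'h \<Rightarrow> real"
  assumes fin: "finite A"
    and sub: "\<And>h. h \<in> A \<Longrightarrow> C h \<subseteq> A"
    and refl: "\<And>h. h \<in> A \<Longrightarrow> h \<in> C h"
    and eq: "\<And>h h'. h \<in> A \<Longrightarrow> h' \<in> C h \<Longrightarrow> C h' = C h"
    and nonneg: "\<And>h. h \<in> A \<Longrightarrow> 0 \<le> r h"
  shows "(\<Sum>h\<in>A. r h * ((\<Sum>h'\<in>C h. r h' * x h') / (\<Sum>h'\<in>C h. r h'))) = (\<Sum>h\<in>A. r h * x h)"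
proof -
  have "(\<Sum>h\<in>A. r h * ((\<Sum>h'\<in>C h. r h' * x h') / (\<Sum>h'\<in>C h. r h')))
      = (\<Sum>h\<in>A. \<Sum>h'\<in>C h. r h * (r h' * x h') / (\<Sum>k\<in>C h. r k))"
    by (simp add: sum_distrib_left sum_divide_distrib)
  \<comment> \<open>Rewriting the denominator in terms of \<open>h'\<close> makes it constant in
    \<open>h\<close>, which becomes the inner index after the swap.\<close>
  also have "\<dots> = (\<Sum>h\<in>A. \<Sum>h'\<in>C h. r h * (r h' * x h') / (\<Sum>k\<in>C h'. r k))"
    using eq by (intro sum.cong) auto
  also have "\<dots> = (\<Sum>h\<in>A. \<Sum>h' | h' \<in> A \<and> h' \<in> C h. r h * (r h' * x h') / (\<Sum>k\<in>C h'. r k))"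
    using sub by (intro sum.cong) auto
  also have "\<dots> = (\<Sum>h'\<in>A. \<Sum>h | h \<in> A \<and> h' \<in> C h. r h * (r h' * x h') / (\<Sum>k\<in>C h'. r k))"
    using fin by (rule sum.swap_restrict[OF _ fin])
  also have "\<dots> = (\<Sum>h'\<in>A. r h' * x h')"
  proof (rule sum.cong[OF HOL.refl])
    fix h' assume h': "h' \<in> A"
    have set: "{h \<in> A. h' \<in> C h} = C h'"
      using h' refl sub eq by blast
    have "(\<Sum>h\<in>C h'. r h * (r h' * x h') / (\<Sum>k\<in>C h'. r k))
        = (\<Sum>h\<in>C h'. r h) * (r h' * x h') / (\<Sum>k\<in>C h'. r k)"
      by (simp add: sum_distrib_right sum_divide_distrib)
    also have "\<dots> = r h' * x h'"
    \<comment> \<open>In a class of weight 0 the quotient is 0 by convention, and nonnegativity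
      forces \<open>r h' = 0\<close>, so both sides vanish.\<close>
    proof (cases "(\<Sum>k\<in>C h'. r k) = 0")
      case True
      then have "r h' = 0"
        using sum_nonneg_eq_0_iff[of "C h'" r] finite_subset[OF sub[OF h'] fin] nonneg sub[OF h'] refl[OF h']
        by blast
      then show ?thesis by simp
    qed simp
    finally show "(\<Sum>h | h \<in> A \<and> h' \<in> C h. r h * (r h' * x h') / (\<Sum>k\<in>C h'. r k)) = r h' * x h'"
      unfolding set .
  qed
  finally show ?thesis .
qed

lemma reach_nonneg: "0 \<le> reach G \<sigma> h"
  unfolding reach_def by (intro prod_nonneg) simp

lemma reach_snoc: "reach G \<sigma> (h @ [a]) = reach G \<sigma> h * pmf (action_dist G \<sigma> h) a"
  unfolding reach_def by (auto simp: nth_append intro!: prod.cong)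

section \<open>Prefixes, terminal histories and private classes in the game tree\<close>

context extensive_form_game
begin

lemma prefix_closed': "prefix h z \<Longrightarrow> z \<in> histories G \<Longrightarrow> h \<in> histories G"
proof (induction z rule: rev_induct)
  case (snoc a z)
  then show ?case using prefix_closed by (auto simp: prefix_snoc)
qed simp

lemma finite_terminals: "finite (terminals G)"
  using finite_histories by (simp add: terminals_def)

lemma finite_actions: "finite (actions G h)"
proof -
  have "(\<lambda>a. h @ [a]) ` actions G h \<subseteq> histories G" by (auto simp: actions_def)
  then show ?thesis
    using finite_histories by (meson finite_imageD finite_subset inj_onI append1_eq_conv)
qed

lemma action_history: "a \<in> actions G h \<Longrightarrow> h @ [a] \<in> histories G"
  by (simp add: actions_def)

lemma prefix_terminal_iff:
  assumes "z \<in> terminals G" "h \<in> terminals G"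
  shows "prefix h z \<longleftrightarrow> z = h"
proof
  assume "prefix h z"
  show "z = h"
  proof (rule ccontr)
    assume "z \<noteq> h"
    then obtain a where "prefix (h @ [a]) z"
      using \<open>prefix h z\<close> by (metis prefix_order.le_imp_less_or_eq strict_prefixE' prefixI append.assoc append_Cons append_Nil)
    then have "a \<in> actions G h"
      using assms prefix_closed' by (auto simp: actions_def terminals_def)
    then show False using assms by (simp add: terminals_def)
  qed
qed simp

lemma private_class_refl: "h \<in> histories G \<Longrightarrow> h \<in> private_class G h"
  by (simp add: private_class_def)

text \<open>By \<open>class_player\<close> the members of a class have the same acting player, so
  membership compares the same components whichever member it starts from.\<close>

lemma private_class_eq:
  assumes "h \<in> histories G" "h' \<in> private_class G h"
  shows "private_class G h' = private_class G h"
  using assms class_player[OF assms] by (auto simp: private_class_def)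

text \<open>Being terminal depends only on the set of available actions, which
  \<open>class_actions\<close> makes constant on a class.\<close>

lemma private_class_terminals: "z \<in> terminals G \<Longrightarrow> private_class G z \<subseteq> terminals G"
  using class_actions by (auto simp: terminals_def private_class_def)

section \<open>Expectations over terminal histories under a fixed profile\<close>

context
  fixes \<sigma>
  assumes profile: "strategy_profile G \<sigma>"
begin

lemma sum_action_dist:
  assumes "h \<in> nonterminals G"
  shows "(\<Sum>a\<in>actions G h. pmf (action_dist G \<sigma> h) a) = 1"
proof -
  have "set_pmf (action_dist G \<sigma> h) \<subseteq> actions G h"
    using assms profile chance_support by (auto simp: strategy_profile_def action_dist_def)
  then show ?thesis by (rule sum_pmf_eq_1[OF finite_actions])
qed

text \<open>The probability mass at \<open>h\<close> is passed on to its successors without loss, so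
  an induction from the leaves upwards finds all of it at the terminal histories below
  \<open>h\<close>.\<close>

lemma sum_reach_terminals:
  assumes "h \<in> histories G"
  shows "(\<Sum>z | z \<in> terminals G \<and> prefix h z. reach G \<sigma> z) = reach G \<sigma> h"
  using assms
proof (induction "Max (length ` histories G) - length h" arbitrary: h rule: less_induct)
  case less
  show ?case
  proof (cases "h \<in> terminals G")
    case True
    then have "{z. z \<in> terminals G \<and> prefix h z} = {h}"
      using prefix_terminal_iff by auto
    then show ?thesis by simp
  next
    case False
    then have nt: "h \<in> nonterminals G" using less.prems by (simp add: nonterminals_def)
    \<comment> \<open>A terminal history extending the nonterminal \<open>h\<close> is longer than
      \<open>h\<close>; its next action places it below exactly one successor.\<close>
    have split: "{z. z \<in> terminals G \<and> prefix h z}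
        = (\<Union>a\<in>actions G h. {z. z \<in> terminals G \<and> prefix (h @ [a]) z})"
    proof (intro equalityI subsetI)
      fix z assume z: "z \<in> {z. z \<in> terminals G \<and> prefix h z}"
      then have "z \<noteq> h" using False by auto
      then obtain a where a: "prefix (h @ [a]) z"
        using z by (metis (lifting) mem_Collect_eq prefix_order.le_imp_less_or_eq strict_prefixE' prefixI append.assoc append_Cons append_Nil)
      then have "a \<in> actions G h"
        using z prefix_closed' by (auto simp: actions_def terminals_def)
      then show "z \<in> (\<Union>a\<in>actions G h. {z. z \<in> terminals G \<and> prefix (h @ [a]) z})"
        using a z by auto
    qed (auto dest: append_prefixD)
    have "(\<Sum>z | z \<in> terminals G \<and> prefix h z. reach G \<sigma> z)
        = (\<Sum>a\<in>actions G h. \<Sum>z | z \<in> terminals G \<and> prefix (h @ [a]) z. reach G \<sigma> z)"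
      unfolding split
      by (rule sum.UNION_disjoint) (auto simp: finite_actions finite_terminals prefix_def)
    also have "\<dots> = (\<Sum>a\<in>actions G h. reach G \<sigma> (h @ [a]))"
    proof (rule sum.cong[OF HOL.refl])
      fix a assume "a \<in> actions G h"
      then have h: "h @ [a] \<in> histories G" by (rule action_history)
      \<comment> \<open>This bound makes the truncated subtraction in the induction measure strictly
        decrease from \<open>h\<close> to \<open>h @ [a]\<close>.\<close>
      then have "length (h @ [a]) \<le> Max (length ` histories G)"
        using finite_histories by (intro Max_ge imageI) auto
      then show "(\<Sum>z | z \<in> terminals G \<and> prefix (h @ [a]) z. reach G \<sigma> z) = reach G \<sigma> (h @ [a])"
        using h by (intro less.hyps) auto
    qed
    also have "\<dots> = reach G \<sigma> h"
      using sum_action_dist[OF nt] by (simp add: reach_snoc flip: sum_distrib_left)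
    finally show ?thesis .
  qed
qed

lemma expectation_aivat_base:
  "terminal_expectation G \<sigma> (aivat_base G \<sigma> v) = terminal_expectation G \<sigma> v"
  unfolding terminal_expectation_def aivat_base_def
proof (rule sum_class_average[OF finite_terminals private_class_terminals])
  fix z assume "z \<in> terminals G"
  then have "z \<in> histories G" by (simp add: terminals_def)
  then show "z \<in> private_class G z"
    and "\<And>z'. z' \<in> private_class G z \<Longrightarrow> private_class G z' = private_class G z"
    by (rule private_class_refl, rule private_class_eq)
qed (auto simp: reach_nonneg)

text \<open>The step \<open>(h, a)\<close> contributes at exactly the terminal histories through
  \<open>h @ [a]\<close>, and their total reach probability is that of
  \<open>h @ [a]\<close>.\<close>

lemma expectation_known_steps:
  assumes D: "D \<subseteq> nonterminals G"
  shows "terminal_expectation G \<sigma> (\<lambda>z. \<Sum>p\<in>known_steps D z. g p)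
    = (\<Sum>h\<in>D. \<Sum>a\<in>actions G h. reach G \<sigma> (h @ [a]) * g (h, a))"
proof -
  let ?S = "Sigma D (actions G)"
  have finD: "finite D"
    using D finite_histories by (auto simp: nonterminals_def intro: finite_subset)
  have finS: "finite ?S" using finD finite_actions by blast
  have "terminal_expectation G \<sigma> (\<lambda>z. \<Sum>p\<in>known_steps D z. g p)
      = (\<Sum>z\<in>terminals G. \<Sum>p | p \<in> ?S \<and> prefix (fst p @ [snd p]) z. reach G \<sigma> z * g p)"
    unfolding terminal_expectation_def sum_distrib_left
  proof (rule sum.cong[OF HOL.refl])
    fix z assume z: "z \<in> terminals G"
    have "known_steps D z = {p. p \<in> ?S \<and> prefix (fst p @ [snd p]) z}"
      using z prefix_closed' by (auto simp: known_steps_def actions_def terminals_def)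
    then show "(\<Sum>p\<in>known_steps D z. reach G \<sigma> z * g p)
        = (\<Sum>p | p \<in> ?S \<and> prefix (fst p @ [snd p]) z. reach G \<sigma> z * g p)" by simp
  qed
  also have "\<dots> = (\<Sum>p\<in>?S. \<Sum>z | z \<in> terminals G \<and> prefix (fst p @ [snd p]) z. reach G \<sigma> z * g p)"
    by (rule sum.swap_restrict[OF finite_terminals finS])
  also have "\<dots> = (\<Sum>p\<in>?S. reach G \<sigma> (fst p @ [snd p]) * g p)"
    by (intro sum.cong)
      (auto simp: sum_reach_terminals action_history simp flip: sum_distrib_right)
  also have "\<dots> = (\<Sum>h\<in>D. \<Sum>a\<in>actions G h. reach G \<sigma> (h @ [a]) * g (h, a))"
    using finD finite_actions by (subst sum.Sigma) (auto simp: case_prod_unfold)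
  finally show ?thesis .
qed

text \<open>Both halves have the expectation \<open>\<Sum>h\<in>D. \<Sum>a\<in>actions G h. ?q h a *
  v' (h @ [a])\<close>. For the first half the class average is taken over \<open>D\<close> itself,
  for the second over the histories of \<open>D\<close> offering a fixed action.\<close>

lemma expectation_aivat_correction:
  assumes D: "known_histories G D"
  shows "terminal_expectation G \<sigma> (aivat_correction G \<sigma> D v') = 0"
proof -
  let ?C = "private_class G"
  let ?q = "\<lambda>h a. reach G \<sigma> (h @ [a])"
  \<comment> \<open>\<open>x h\<close> is the mean of \<open>v'\<close> one action after
    \<open>h\<close>; with it the numerator \<open>N h\<close> becomes a reach-weighted class
    sum.\<close>
  define x where "x h = (\<Sum>a\<in>actions G h. pmf (action_dist G \<sigma> h) a * v' (h @ [a]))" for h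
  define N where "N h = (\<Sum>a\<in>actions G h. \<Sum>h'\<in>?C h. ?q h' a * v' (h' @ [a]))" for h
  define P where "P h = (\<Sum>h'\<in>?C h. reach G \<sigma> h')" for h
  define Q where "Q h a = (\<Sum>h'\<in>?C h. ?q h' a * v' (h' @ [a])) / (\<Sum>h'\<in>?C h. ?q h' a)" for h a
  have Dnt: "D \<subseteq> nonterminals G" and Dcl: "\<And>h. h \<in> D \<Longrightarrow> ?C h \<subseteq> D"
    using D by (auto simp: known_histories_def)
  then have Dh: "\<And>h. h \<in> D \<Longrightarrow> h \<in> histories G" by (auto simp: nonterminals_def)
  then have finD: "finite D" using finite_histories by (auto intro: finite_subset)
  have N: "N h = (\<Sum>h'\<in>?C h. reach G \<sigma> h' * x h')" if "h \<in> D" for h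
  proof -
    have "N h = (\<Sum>h'\<in>?C h. \<Sum>a\<in>actions G h. ?q h' a * v' (h' @ [a]))"
      unfolding N_def by (rule sum.swap)
    also have "\<dots> = (\<Sum>h'\<in>?C h. reach G \<sigma> h' * x h')"
      using class_actions[OF Dh[OF that]]
      by (intro sum.cong) (auto simp: x_def sum_distrib_left reach_snoc mult.assoc)
    finally show ?thesis .
  qed
  have "terminal_expectation G \<sigma> (aivat_correction G \<sigma> D v')
      = (\<Sum>h\<in>D. \<Sum>a\<in>actions G h. ?q h a * (N h / P h - Q h a))"
    using expectation_known_steps[OF Dnt, of "\<lambda>(h, a). N h / P h - Q h a"]
    by (simp add: aivat_correction_def[abs_def] N_def P_def Q_def)
  also have "\<dots> = (\<Sum>h\<in>D. \<Sum>a\<in>actions G h. ?q h a * (N h / P h))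
      - (\<Sum>h\<in>D. \<Sum>a\<in>actions G h. ?q h a * Q h a)"
    by (simp add: right_diff_distrib sum_subtractf)
  \<comment> \<open>The first half does not depend on the action taken, so the action probabilities
    sum out to 1.\<close>
  also have "(\<Sum>h\<in>D. \<Sum>a\<in>actions G h. ?q h a * (N h / P h)) = (\<Sum>h\<in>D. reach G \<sigma> h * (N h / P h))"
    using Dnt sum_action_dist
    by (intro sum.cong) (auto simp: reach_snoc simp flip: sum_distrib_left sum_distrib_right sum_divide_distrib)
  also have "\<dots> = (\<Sum>h\<in>D. reach G \<sigma> h * ((\<Sum>h'\<in>?C h. reach G \<sigma> h' * x h') / P h))"
    by (intro sum.cong) (auto simp: N)
  also have "\<dots> = (\<Sum>h\<in>D. reach G \<sigma> h * x h)"
    unfolding P_def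
    by (rule sum_class_average[OF finD])
      (auto simp: Dh private_class_refl private_class_eq reach_nonneg dest: Dcl)
  also have "\<dots> = (\<Sum>h\<in>D. \<Sum>a\<in>actions G h. ?q h a * v' (h @ [a]))"
    by (simp add: x_def sum_distrib_left reach_snoc mult.assoc)
  also have "(\<Sum>h\<in>D. \<Sum>a\<in>actions G h. ?q h a * Q h a) = (\<Sum>h\<in>D. \<Sum>a\<in>actions G h. ?q h a * v' (h @ [a]))"
  proof -
    let ?A = "\<Union>h\<in>D. actions G h"
    have finA: "finite ?A" using finD finite_actions by blast
    \<comment> \<open>With the action outermost, \<open>sum_class_average\<close> applies for each
      fixed \<open>a\<close> with weights \<open>?q h a\<close>: the histories of \<open>D\<close>
      offering \<open>a\<close> form a union of classes by \<open>Dcl\<close> and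
      \<open>class_actions\<close>.\<close>
    have swap: "(\<Sum>h\<in>D. \<Sum>a\<in>actions G h. f h a) = (\<Sum>a\<in>?A. \<Sum>h | h \<in> D \<and> a \<in> actions G h. f h a)"
      for f :: "_ \<Rightarrow> _ \<Rightarrow> real"
    proof -
      have "(\<Sum>h\<in>D. \<Sum>a\<in>actions G h. f h a) = (\<Sum>h\<in>D. \<Sum>a | a \<in> ?A \<and> a \<in> actions G h. f h a)"
        by (intro sum.cong) auto
      also have "\<dots> = (\<Sum>a\<in>?A. \<Sum>h | h \<in> D \<and> a \<in> actions G h. f h a)"
        by (rule sum.swap_restrict[OF finD finA])
      finally show ?thesis .
    qed
    have "(\<Sum>h | h \<in> D \<and> a \<in> actions G h. ?q h a * Q h a)
        = (\<Sum>h | h \<in> D \<and> a \<in> actions G h. ?q h a * v' (h @ [a]))" for a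
      unfolding Q_def
    proof (rule sum_class_average)
      fix h assume "h \<in> {h. h \<in> D \<and> a \<in> actions G h}"
      then show "?C h \<subseteq> {h. h \<in> D \<and> a \<in> actions G h}"
        using Dcl[of h] class_actions[OF Dh, of h] by auto
    qed (auto simp: finD Dh private_class_refl private_class_eq reach_nonneg)
    then show ?thesis by (simp add: swap)
  qed
  finally show ?thesis by simp
qed

lemma expectation_aivat:
  assumes "known_histories G D"
  shows "terminal_expectation G \<sigma> (aivat G \<sigma> D v v') = terminal_expectation G \<sigma> v"
proof -
  have "terminal_expectation G \<sigma> (aivat G \<sigma> D v v')
      = terminal_expectation G \<sigma> (aivat_base G \<sigma> v) + terminal_expectation G \<sigma> (aivat_correction G \<sigma> D v')"
    by (simp add: terminal_expectation_def aivat_def distrib_left sum.distrib)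
  then show ?thesis
    using expectation_aivat_base expectation_aivat_correction[OF assms] by simp
qed

end

end

section \<open>The weak law of large numbers in mean\<close>

context prob_space
begin

text \<open>Independence and zero means remove the off-diagonal products, leaving
  \<open>card I\<close> squares, each at most \<open>K\<^sup>2\<close>.\<close>

lemma square_expectation_indep_sum:
  fixes X :: "'b \<Rightarrow> 'a \<Rightarrow> real" and K :: real
  assumes fin: "finite I"
    and indep: "indep_vars (\<lambda>_. borel) X I"
    and bound: "\<And>i x. i \<in> I \<Longrightarrow> x \<in> space M \<Longrightarrow> \<bar>X i x\<bar> \<le> K"
    and zero: "\<And>i. i \<in> I \<Longrightarrow> expectation (X i) = 0"
  shows "expectation (\<lambda>x. (\<Sum>i\<in>I. X i x)\<^sup>2) \<le> card I * K\<^sup>2"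
proof -
  have rv[measurable]: "random_variable borel (X i)" if "i \<in> I" for i
    using indep that by (simp add: indep_vars_def)
  have int: "integrable M (X i)" if "i \<in> I" for i
    using that bound by (intro integrable_const_bound[where B = K]) auto
  have int2: "integrable M (\<lambda>x. X i x * X j x)" if "i \<in> I" "j \<in> I" for i j
  proof (rule integrable_const_bound[where B = "K * K"])
    show "AE x in M. norm (X i x * X j x) \<le> K * K"
      using bound[OF that(1)] bound[OF that(2)]
      by (intro AE_I2) (auto simp: abs_mult intro!: mult_mono intro: order_trans[OF abs_ge_zero])
  qed (use that in measurable)
  have cross: "expectation (\<lambda>x. X i x * X j x) = 0" if "i \<in> I" "j \<in> I" "i \<noteq> j" for i j
  proof -
    have "indep_vars (\<lambda>_. borel) X {i, j}"
      using indep by (rule indep_vars_subset) (use that in auto)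
    then have "expectation (\<lambda>x. \<Prod>k\<in>{i, j}. X k x) = (\<Prod>k\<in>{i, j}. expectation (X k))"
      by (rule indep_vars_lebesgue_integral[rotated]) (use that int in auto)
    then show ?thesis using that zero by simp
  qed
  have diag: "expectation (\<lambda>x. X i x * X i x) \<le> K\<^sup>2" if "i \<in> I" for i
  proof -
    have "expectation (\<lambda>x. X i x * X i x) \<le> expectation (\<lambda>x. K\<^sup>2)"
    proof (rule integral_mono[OF int2[OF that that]])
      fix x assume "x \<in> space M"
      then have "\<bar>X i x\<bar> \<le> K" using bound that by blast
      then show "X i x * X i x \<le> K\<^sup>2"
        using power_mono[of "\<bar>X i x\<bar>" K 2] by (simp add: power2_eq_square)
    qed simp
    then show ?thesis by (simp add: prob_space)
  qed
  have "expectation (\<lambda>x. (\<Sum>i\<in>I. X i x)\<^sup>2) = (\<Sum>i\<in>I. \<Sum>j\<in>I. expectation (\<lambda>x. X i x * X j x))"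
    by (simp add: power2_eq_square sum_product int2)
  also have "\<dots> = (\<Sum>i\<in>I. expectation (\<lambda>x. X i x * X i x))"
  proof (rule sum.cong[OF refl])
    fix i assume "i \<in> I"
    then have "(\<Sum>j\<in>I. expectation (\<lambda>x. X i x * X j x))
        = expectation (\<lambda>x. X i x * X i x) + (\<Sum>j\<in>I - {i}. expectation (\<lambda>x. X i x * X j x))"
      using fin by (simp add: sum.remove)
    also have "(\<Sum>j\<in>I - {i}. expectation (\<lambda>x. X i x * X j x)) = 0"
      using cross \<open>i \<in> I\<close> by (intro sum.neutral) auto
    finally show "(\<Sum>j\<in>I. expectation (\<lambda>x. X i x * X j x)) = expectation (\<lambda>x. X i x * X i x)"
      by simp
  qed
  also have "\<dots> \<le> (\<Sum>i\<in>I. K\<^sup>2)"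
    by (intro sum_mono diag)
  finally show ?thesis by simp
qed

text \<open>This is the nonnegativity of the variance of the absolute value of
  \<open>X\<close>.\<close>

lemma expectation_abs_le_sqrt:
  fixes X :: "'a \<Rightarrow> real"
  assumes "integrable M X" "integrable M (\<lambda>x. (X x)\<^sup>2)"
  shows "expectation (\<lambda>x. \<bar>X x\<bar>) \<le> sqrt (expectation (\<lambda>x. (X x)\<^sup>2))"
proof (rule real_le_rsqrt)
  have "0 \<le> variance (\<lambda>x. \<bar>X x\<bar>)" by (rule variance_positive)
  also have "\<dots> = expectation (\<lambda>x. (X x)\<^sup>2) - (expectation (\<lambda>x. \<bar>X x\<bar>))\<^sup>2"
    using assms by (subst variance_eq) auto
  finally show "(expectation (\<lambda>x. \<bar>X x\<bar>))\<^sup>2 \<le> expectation (\<lambda>x. (X x)\<^sup>2)" by simp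
qed

text \<open>Dominated convergence: at each point the truncation error vanishes once \<open>n\<close>
  exceeds the absolute value of \<open>X\<close> there, and that absolute value dominates it
  throughout.\<close>

lemma expectation_tail_tendsto_0:
  fixes X :: "'a \<Rightarrow> real"
  assumes X: "integrable M X"
  shows "(\<lambda>n. expectation (\<lambda>x. \<bar>X x - (if \<bar>X x\<bar> \<le> real n then X x else 0)\<bar>)) \<longlonglongrightarrow> 0"
proof -
  have [measurable]: "X \<in> borel_measurable M" using X by simp
  have "(\<lambda>n. expectation (\<lambda>x. \<bar>X x - (if \<bar>X x\<bar> \<le> real n then X x else 0)\<bar>)) \<longlonglongrightarrow> expectation (\<lambda>x. 0)"
  proof (rule integral_dominated_convergence[where w = "\<lambda>x. \<bar>X x\<bar>"])
    show "AE x in M. (\<lambda>n. \<bar>X x - (if \<bar>X x\<bar> \<le> real n then X x else 0)\<bar>) \<longlonglongrightarrow> 0"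
    proof (rule AE_I2)
      fix x
      obtain N :: nat where "\<bar>X x\<bar> \<le> real N" using real_arch_simple by blast
      then have "eventually (\<lambda>n. \<bar>X x - (if \<bar>X x\<bar> \<le> real n then X x else 0)\<bar> = 0) sequentially"
        by (intro eventually_sequentiallyI[of N]) auto
      then show "(\<lambda>n. \<bar>X x - (if \<bar>X x\<bar> \<le> real n then X x else 0)\<bar>) \<longlonglongrightarrow> 0"
        by (rule tendsto_eventually)
    qed
  qed (use X in auto)
  then show ?thesis by simp
qed

text \<open>Truncating at level \<open>K\<close> splits the error into a bounded centred part, of order
  \<open>1 / \<surd>T\<close> in \<open>L\<^sup>2\<close>, and two tails that are small uniformly in \<open>T\<close>; no second moment is needed.\<close>

lemma weak_law_L1:
  fixes X :: "nat \<Rightarrow> 'a \<Rightarrow> real"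
  assumes indep: "indep_vars (\<lambda>_. borel) X {1..}"
    and X0: "integrable M X0"
    and distr: "\<And>t. t \<ge> 1 \<Longrightarrow> distr M borel (X t) = distr M borel X0"
  shows "(\<lambda>T. expectation (\<lambda>x. \<bar>(\<Sum>t=1..T. X t x) / T - expectation X0\<bar>)) \<longlonglongrightarrow> 0"
proof (rule LIMSEQ_I)
  fix e :: real assume e: "0 < e"
  have rv: "random_variable borel (X t)" if "t \<ge> 1" for t
    using indep that by (simp add: indep_vars_def)
  have X0m[measurable]: "random_variable borel X0" using X0 by simp
  have transfer: "expectation (\<lambda>x. f (X t x)) = expectation (\<lambda>x. f (X0 x))"
    if "t \<ge> 1" and [measurable]: "f \<in> borel_measurable borel" for t and f :: "real \<Rightarrow> real"
  proof -
    have "expectation (\<lambda>x. f (X t x)) = integral\<^sup>L (distr M borel (X t)) f"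
      using rv[OF that(1)] by (simp add: integral_distr)
    then show ?thesis using distr[OF that(1)] by (simp add: integral_distr)
  qed
  have transfer_int: "integrable M (\<lambda>x. f (X t x)) \<longleftrightarrow> integrable M (\<lambda>x. f (X0 x))"
    if "t \<ge> 1" and [measurable]: "f \<in> borel_measurable borel" for t and f :: "real \<Rightarrow> real"
  proof -
    have "integrable M (\<lambda>x. f (X t x)) \<longleftrightarrow> integrable (distr M borel (X t)) f"
      using rv[OF that(1)] by (simp add: integrable_distr_eq)
    then show ?thesis using distr[OF that(1)] by (simp add: integrable_distr_eq)
  qed
  define c where "c K y = (if \<bar>y\<bar> \<le> K then y else 0)" for K y :: real
  have cm[measurable]: "c K \<in> borel_measurable borel" for K
    unfolding c_def[abs_def] by measurable
  \<comment> \<open>The level is fixed before \<open>T\<close>. Two tails, one from the sample and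
    one from the mean, use less than \<open>e / 2\<close>; the other \<open>e / 2\<close> is left
    for the centred part.\<close>
  obtain n :: nat where n: "expectation (\<lambda>x. \<bar>X0 x - c (real n) (X0 x)\<bar>) < e / 4"
    using order_tendstoD(2)[OF expectation_tail_tendsto_0[OF X0], of "e / 4"] e
    by (auto simp: c_def dest!: eventually_happens)
  define K where "K = real n"
  define d where "d = expectation (\<lambda>x. \<bar>X0 x - c K (X0 x)\<bar>)"
  have d: "d < e / 4" using n by (simp add: d_def K_def)
  have c_bound: "\<bar>c K y\<bar> \<le> K" for y by (simp add: c_def K_def)
  define m where "m = expectation (\<lambda>x. c K (X0 x))"
  have int_c0: "integrable M (\<lambda>x. c K (X0 x))"
    using c_bound by (intro integrable_const_bound[where B = K]) auto
  have m_bound: "\<bar>m\<bar> \<le> K"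
  proof -
    have "\<bar>m\<bar> \<le> expectation (\<lambda>x. \<bar>c K (X0 x)\<bar>)"
      unfolding m_def by (rule integral_abs_bound)
    also have "\<dots> \<le> expectation (\<lambda>x. K)"
      using int_c0 c_bound by (intro integral_mono) auto
    finally show ?thesis by (simp add: prob_space)
  qed
  \<comment> \<open>Truncation moves the mean by at most the tail \<open>d\<close>.\<close>
  have m_dist: "\<bar>expectation X0 - m\<bar> \<le> d"
  proof -
    have "expectation X0 - m = expectation (\<lambda>x. X0 x - c K (X0 x))"
      using X0 int_c0 by (simp add: m_def)
    then show ?thesis unfolding d_def by (metis integral_abs_bound)
  qed
  have bound: "expectation (\<lambda>x. \<bar>(\<Sum>t=1..T. X t x) / T - expectation X0\<bar>) \<le> 2 * K / sqrt T + 2 * d"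
    if T: "T \<ge> 1" for T :: nat
  proof -
    define S where "S x = (\<Sum>t=1..T. c K (X t x) - m)" for x
    have rvT[measurable]: "random_variable borel (X t)" if "t \<in> {1..T}" for t
      using rv that by simp
    have Sm[measurable]: "random_variable borel S"
      unfolding S_def[abs_def] by measurable
    have cX_bound: "\<bar>c K y - m\<bar> \<le> 2 * K" for y
      using c_bound[of y] m_bound by linarith
    have S_bound: "\<bar>S x\<bar> \<le> T * (2 * K)" for x
    proof -
      have "\<bar>S x\<bar> \<le> (\<Sum>t=1..T. \<bar>c K (X t x) - m\<bar>)" unfolding S_def by (rule sum_abs)
      also have "\<dots> \<le> (\<Sum>t=1..T. 2 * K)" by (intro sum_mono cX_bound)
      finally show ?thesis by simp
    qed
    have intS: "integrable M S"
      using S_bound by (intro integrable_const_bound[where B = "T * (2 * K)"]) auto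
    have "(S x)\<^sup>2 \<le> (T * (2 * K))\<^sup>2" for x
      using S_bound[of x] by (intro abs_le_square_iff[THEN iffD1]) (simp add: K_def)
    then have intS2: "integrable M (\<lambda>x. (S x)\<^sup>2)"
      by (intro integrable_const_bound[where B = "(T * (2 * K))\<^sup>2"]) auto
    have "expectation (\<lambda>x. (S x)\<^sup>2) \<le> card {1..T} * (2 * K)\<^sup>2"
      unfolding S_def
    proof (rule square_expectation_indep_sum)
      have "indep_vars (\<lambda>_. borel) X {1..T}"
        using indep by (rule indep_vars_subset) auto
      then show "indep_vars (\<lambda>_. borel) (\<lambda>t x. c K (X t x) - m) {1..T}"
        by (rule indep_vars_compose2[where Y = "\<lambda>_ y. c K y - m"]) measurable
      show "expectation (\<lambda>x. c K (X t x) - m) = 0" if "t \<in> {1..T}" for t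
      proof -
        have "t \<ge> 1" using that by simp
        show ?thesis
          using transfer[OF \<open>t \<ge> 1\<close> cm[of K]] transfer_int[OF \<open>t \<ge> 1\<close> cm[of K]] int_c0
          by (simp add: m_def prob_space)
      qed
    qed (use cX_bound in auto)
    then have "sqrt (expectation (\<lambda>x. (S x)\<^sup>2)) \<le> sqrt (T * (2 * K)\<^sup>2)"
      by simp
    also have "\<dots> = sqrt T * (2 * K)" by (simp add: real_sqrt_mult K_def)
    finally have ES: "expectation (\<lambda>x. \<bar>S x\<bar>) \<le> sqrt T * (2 * K)"
      using expectation_abs_le_sqrt[OF intS intS2] by linarith
    have tail: "expectation (\<lambda>x. \<bar>X t x - c K (X t x)\<bar>) = d"
      "integrable M (\<lambda>x. \<bar>X t x - c K (X t x)\<bar>)" "integrable M (X t)" if "t \<in> {1..T}" for t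
    proof -
      have "t \<ge> 1" using that by simp
      have [measurable]: "(\<lambda>y. \<bar>y - c K y\<bar>) \<in> borel_measurable borel" by measurable
      show "expectation (\<lambda>x. \<bar>X t x - c K (X t x)\<bar>) = d"
        unfolding d_def by (rule transfer[OF \<open>t \<ge> 1\<close>, of "\<lambda>y. \<bar>y - c K y\<bar>"]) measurable
      show "integrable M (\<lambda>x. \<bar>X t x - c K (X t x)\<bar>)"
        using transfer_int[OF \<open>t \<ge> 1\<close>, of "\<lambda>y. \<bar>y - c K y\<bar>"] X0 int_c0 by simp
      show "integrable M (X t)"
        using transfer_int[OF \<open>t \<ge> 1\<close>, of "\<lambda>y. y"] X0 by simp
    qed
    have sum_int: "integrable M (\<lambda>x. \<Sum>t=1..T. X t x)"
      "integrable M (\<lambda>x. \<Sum>t=1..T. \<bar>X t x - c K (X t x)\<bar>)"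
      by (rule Bochner_Integration.integrable_sum, rule tail, assumption)+
    have "expectation (\<lambda>x. \<bar>(\<Sum>t=1..T. X t x) / T - expectation X0\<bar>)
        \<le> expectation (\<lambda>x. \<bar>S x\<bar> / T + (\<Sum>t=1..T. \<bar>X t x - c K (X t x)\<bar>) / T + d)"
    proof (rule integral_mono)
      fix x
      \<comment> \<open>Three errors are separated: the centred truncated sum, the truncation of the
        sample, and the truncation of the mean.\<close>
      have "(\<Sum>t=1..T. X t x) = S x + (\<Sum>t=1..T. X t x - c K (X t x)) + T * m"
        by (simp add: S_def sum_subtractf)
      then have "(\<Sum>t=1..T. X t x) / T - expectation X0
          = S x / T + (\<Sum>t=1..T. X t x - c K (X t x)) / T + (m - expectation X0)"
        using T by (simp add: field_simps)
      moreover have "\<bar>S x / T\<bar> = \<bar>S x\<bar> / T" by simp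
      moreover have "\<bar>(\<Sum>t=1..T. X t x - c K (X t x)) / T\<bar> \<le> (\<Sum>t=1..T. \<bar>X t x - c K (X t x)\<bar>) / T"
        by (simp add: divide_right_mono sum_abs)
      ultimately show "\<bar>(\<Sum>t=1..T. X t x) / T - expectation X0\<bar>
          \<le> \<bar>S x\<bar> / T + (\<Sum>t=1..T. \<bar>X t x - c K (X t x)\<bar>) / T + d"
        using m_dist by linarith
    next
      show "integrable M (\<lambda>x. \<bar>(\<Sum>t=1..T. X t x) / T - expectation X0\<bar>)"
        using sum_int(1) by simp
      show "integrable M (\<lambda>x. \<bar>S x\<bar> / T + (\<Sum>t=1..T. \<bar>X t x - c K (X t x)\<bar>) / T + d)"
        using intS sum_int(2) by simp
    qed
    also have "\<dots> = expectation (\<lambda>x. \<bar>S x\<bar>) / T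
        + expectation (\<lambda>x. \<Sum>t=1..T. \<bar>X t x - c K (X t x)\<bar>) / T + d"
      using intS sum_int(2) by (simp add: prob_space)
    also have "expectation (\<lambda>x. \<Sum>t=1..T. \<bar>X t x - c K (X t x)\<bar>) = T * d"
      using tail by (subst Bochner_Integration.integral_sum) auto
    also have "expectation (\<lambda>x. \<bar>S x\<bar>) / T + T * d / T + d = expectation (\<lambda>x. \<bar>S x\<bar>) / T + d + d"
      using T by simp
    also have "\<dots> \<le> sqrt T * (2 * K) / T + 2 * d"
      using ES T by (simp add: divide_right_mono)
    also have "sqrt T * (2 * K) / T = 2 * K / sqrt T"
      using T by (simp add: field_simps)
    finally show ?thesis .
  qed
  \<comment> \<open>Only the centred part depends on \<open>T\<close>, and \<open>K\<close> is now a
    constant.\<close>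
  have "(\<lambda>T. 2 * K / sqrt (real T)) \<longlonglongrightarrow> 0"
    by (intro tendsto_divide_0[OF tendsto_const] filterlim_at_top_imp_at_infinity filterlim_compose[OF sqrt_at_top filterlim_real_sequentially])
  then have "eventually (\<lambda>T. 2 * K / sqrt (real T) < e / 2) sequentially"
    using e by (intro order_tendstoD) auto
  then obtain T0 where T0: "\<And>T. T \<ge> T0 \<Longrightarrow> 2 * K / sqrt (real T) < e / 2"
    by (auto simp: eventually_sequentially)
  have "norm (expectation (\<lambda>x. \<bar>(\<Sum>t=1..T. X t x) / T - expectation X0\<bar>) - 0) < e"
    if "T \<ge> max 1 T0" for T
  proof -
    have "T \<ge> 1" "T \<ge> T0" using that by auto
    have "0 \<le> expectation (\<lambda>x. \<bar>(\<Sum>t=1..T. X t x) / T - expectation X0\<bar>)"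
      by simp
    then show ?thesis
      using bound[OF \<open>T \<ge> 1\<close>] T0[OF \<open>T \<ge> T0\<close>] d by simp
  qed
  then show "\<exists>T0. \<forall>T\<ge>T0. norm (expectation (\<lambda>x. \<bar>(\<Sum>t=1..T. X t x) / T - expectation X0\<bar>) - 0) < e"
    by blast
qed

end

section \<open>Weighted averages\<close>

lemma expectation_random_terminal:
  assumes "finite (terminals G)" "random_terminal M G \<sigma> z"
  shows "(\<integral>x. f (z x) \<partial>M) = terminal_expectation G \<sigma> f"
  using distributed_integral[of M "count_space (terminals G)" z "reach G \<sigma>" f] assms
  by (simp add: random_terminal_def terminal_expectation_def reach_nonneg lebesgue_integral_count_space_finite)

text \<open>The bound is the sum of all absolute values over the finitely many terminal histories.
  Stating it also on \<open>terminals G\<close> lets a single \<open>B\<close> serve every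
  trial.\<close>

lemma random_terminal_compose:
  fixes f :: "'a list \<Rightarrow> real"
  assumes "finite (terminals G)" "random_terminal M G \<sigma> z"
  obtains B where "(\<lambda>x. f (z x)) \<in> borel_measurable M" "\<And>x. x \<in> space M \<Longrightarrow> \<bar>f (z x)\<bar> \<le> B"
    "\<And>\<zeta>. \<zeta> \<in> terminals G \<Longrightarrow> \<bar>f \<zeta>\<bar> \<le> B"
proof
  have z: "z \<in> measurable M (count_space (terminals G))"
    using assms by (auto simp: random_terminal_def distributed_def)
  show "(\<lambda>x. f (z x)) \<in> borel_measurable M"
    using measurable_compose[OF z, of f borel] by simp
  show b: "\<bar>f \<zeta>\<bar> \<le> (\<Sum>\<zeta>\<in>terminals G. \<bar>f \<zeta>\<bar>)" if "\<zeta> \<in> terminals G" for \<zeta>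
    using assms(1) that by (intro member_le_sum) auto
  show "\<bar>f (z x)\<bar> \<le> (\<Sum>\<zeta>\<in>terminals G. \<bar>f \<zeta>\<bar>)" if "x \<in> space M" for x
    using measurable_space[OF z that] b by simp
qed

lemma integrable_mult_bounded:
  fixes w y :: "'a \<Rightarrow> real"
  assumes w: "integrable M w" and y: "y \<in> borel_measurable M" "\<And>x. x \<in> space M \<Longrightarrow> \<bar>y x\<bar> \<le> B"
  shows "integrable M (\<lambda>x. w x * y x)"
proof (rule Bochner_Integration.integrable_bound[OF integrable_mult_left[OF w, of B]])
  show "AE x in M. norm (w x * y x) \<le> norm (w x * B)"
    using y(2) by (intro AE_I2) (force simp: abs_mult intro!: mult_left_mono)
  show "(\<lambda>x. w x * y x) \<in> borel_measurable M" using w y(1) by simp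
qed

context prob_space
begin

text \<open>A normalized weight involves all the weights at once, so independence is taken between
  the whole vector of weights and the whole vector of data. Dependence inside either vector is
  allowed.\<close>

lemma expectation_weighted_avg_indep:
  fixes w y :: "nat \<Rightarrow> 'a \<Rightarrow> real"
  assumes T: "T \<ge> 1"
    and w: "\<And>t. t \<in> {1..T} \<Longrightarrow> random_weight M (w t)"
    and y: "\<And>t. t \<in> {1..T} \<Longrightarrow> integrable M (y t)"
    and mean: "\<And>t. t \<in> {1..T} \<Longrightarrow> expectation (y t) = \<mu>"
    and indep: "indep_var (Pi\<^sub>M {1..T} (\<lambda>_. borel)) (\<lambda>x. \<lambda>t\<in>{1..T}. w t x)
      (Pi\<^sub>M {1..T} (\<lambda>_. borel)) (\<lambda>x. \<lambda>t\<in>{1..T}. y t x)"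
  shows "expectation (weighted_avg T w y) = \<mu>"
proof -
  let ?P = "Pi\<^sub>M {1..T} (\<lambda>_. borel :: real measure)"
  define q where "q t x = w t x / (\<Sum>s=1..T. w s x)" for t x
  have wm[measurable]: "random_variable borel (w t)" if "t \<in> {1..T}" for t
    using w[OF that] by (auto simp: random_weight_def)
  have pos: "AE x in M. \<forall>t\<in>{1..T}. 0 < w t x"
    using w by (intro AE_finite_allI) (auto simp: random_weight_def)
  have qm[measurable]: "random_variable borel (q t)" if "t \<in> {1..T}" for t
    using that unfolding q_def[abs_def] by measurable
  \<comment> \<open>Almost surely all weights are positive, so each normalized weight lies between 0
    and 1.\<close>
  have qint: "integrable M (q t)" if "t \<in> {1..T}" for t
  proof (rule integrable_const_bound[where B = 1])
    show "AE x in M. norm (q t x) \<le> 1"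
      using pos
    proof eventually_elim
      case (elim x)
      then have "w t x \<le> (\<Sum>s=1..T. w s x)"
        using that by (intro member_le_sum) (auto intro: less_imp_le)
      moreover have "0 < w t x" using elim that by blast
      ultimately have "0 < w t x" "0 < (\<Sum>s=1..T. w s x)" "w t x \<le> (\<Sum>s=1..T. w s x)" by linarith+
      then show ?case by (simp add: q_def)
    qed
  qed (use that in measurable)
  have prod: "expectation (\<lambda>x. q t x * y t x) = expectation (q t) * \<mu>"
    and prod_int: "integrable M (\<lambda>x. q t x * y t x)" if t: "t \<in> {1..T}" for t
  proof -
    have [measurable]: "(\<lambda>f. f s) \<in> borel_measurable ?P" if "s \<in> {1..T}" for s
      using that by (rule measurable_component_singleton)
    \<comment> \<open>Normalizing and picking a component are measurable maps of the two vectors, so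
      they preserve independence.\<close>
    have "indep_var borel ((\<lambda>f. f t / (\<Sum>s=1..T. f s)) \<circ> (\<lambda>x. \<lambda>t\<in>{1..T}. w t x))
      borel ((\<lambda>f. f t) \<circ> (\<lambda>x. \<lambda>t\<in>{1..T}. y t x))"
      by (rule indep_var_compose[OF indep]) (use t in measurable)
    moreover have "(\<lambda>f. f t / (\<Sum>s=1..T. f s)) \<circ> (\<lambda>x. \<lambda>t\<in>{1..T}. w t x) = q t"
      using t by (auto simp: q_def fun_eq_iff)
    moreover have "(\<lambda>f. f t) \<circ> (\<lambda>x. \<lambda>t\<in>{1..T}. y t x) = y t"
      using t by (auto simp: fun_eq_iff)
    ultimately have "indep_var borel (q t) borel (y t)" by simp
    then show "expectation (\<lambda>x. q t x * y t x) = expectation (q t) * \<mu>"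
      and "integrable M (\<lambda>x. q t x * y t x)"
      using indep_var_lebesgue_integral[OF _ qint[OF t] y[OF t]]
        indep_var_integrable[OF _ qint[OF t] y[OF t]] mean[OF t] by auto
  qed
  have "expectation (weighted_avg T w y) = expectation (\<lambda>x. \<Sum>t=1..T. q t x * y t x)"
    by (simp add: weighted_avg_def[abs_def] q_def sum_divide_distrib)
  also have "\<dots> = (\<Sum>t=1..T. expectation (q t) * \<mu>)"
    using prod prod_int by simp
  also have "\<dots> = expectation (\<lambda>x. \<Sum>t=1..T. q t x) * \<mu>"
    using qint by (simp add: sum_distrib_right)
  also have "expectation (\<lambda>x. \<Sum>t=1..T. q t x) = expectation (\<lambda>x. 1)"
  proof (rule integral_cong_AE)
    show "AE x in M. (\<Sum>t=1..T. q t x) = 1"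
      using pos
    proof eventually_elim
      case (elim x)
      then have "0 < (\<Sum>s=1..T. w s x)" using T by (intro sum_pos) auto
      then show ?case by (simp add: q_def flip: sum_divide_distrib)
    qed
  qed measurable
  finally show ?thesis by (simp add: prob_space)
qed

section \<open>Mean weight, covariance and the limit of the weighted average\<close>

lemma expectation_random_weight_pos:
  assumes "random_weight M w"
  shows "0 < expectation w"
proof -
  have w: "integrable M w" "AE x in M. 0 < w x" using assms by (auto simp: random_weight_def)
  have "0 \<le> expectation w" using w(2) by (intro integral_nonneg_AE) auto
  \<comment> \<open>A nonnegative function with integral 0 vanishes almost everywhere, against the
    positivity of \<open>w\<close> on a probability space.\<close>
  moreover have "expectation w \<noteq> 0"
  proof
    assume "expectation w = 0"
    moreover have "AE x in M. 0 \<le> w x" using w(2) by eventually_elim simp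
    ultimately have "AE x in M. w x = 0"
      using integral_nonneg_eq_0_iff_AE[OF w(1)] by blast
    then have "AE x in M. False" using w(2) by eventually_elim simp
    then show False by simp
  qed
  ultimately show ?thesis by simp
qed

lemma covariance_eq:
  fixes X Y :: "'a \<Rightarrow> real"
  assumes "integrable M X" "integrable M Y" "integrable M (\<lambda>x. X x * Y x)"
  shows "covariance M X Y = expectation (\<lambda>x. X x * Y x) - expectation X * expectation Y"
proof -
  have "covariance M X Y = expectation (\<lambda>x. X x * Y x - expectation Y * X x - expectation X * Y x
      + expectation X * expectation Y)"
    unfolding covariance_def by (simp add: algebra_simps)
  then show ?thesis using assms by (simp add: prob_space)
qed

lemma weighted_avg_expectation_limit:
  fixes w y :: "nat \<Rightarrow> 'a \<Rightarrow> real"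
  assumes w: "\<And>t. t \<ge> 1 \<Longrightarrow> random_weight M (w t)"
    and y: "\<And>t x. t \<ge> 1 \<Longrightarrow> x \<in> space M \<Longrightarrow> \<bar>y t x\<bar> \<le> B"
    and w0: "random_weight M w0"
    and y0: "random_variable borel y0" "\<And>x. x \<in> space M \<Longrightarrow> \<bar>y0 x\<bar> \<le> B"
    and indep: "indep_vars (\<lambda>_. borel) (\<lambda>t x. (w t x, y t x)) {1..}"
    and distr: "\<And>t. t \<ge> 1 \<Longrightarrow>
      distr M borel (\<lambda>x. (w t x, y t x)) = distr M borel (\<lambda>x. (w0 x, y0 x))"
  shows "(\<lambda>T. expectation (weighted_avg T w y))
    \<longlonglongrightarrow> expectation (\<lambda>x. w0 x * y0 x) / expectation w0"
proof -
  define m where "m = expectation w0"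
  \<comment> \<open>This is the mean of \<open>y0\<close> under the law reweighted by
    \<open>w0 / m\<close>; it is the constant for which \<open>w0 * (y0 - c)\<close> has mean
    0.\<close>
  define c where "c = expectation (\<lambda>x. w0 x * y0 x) / m"
  have m: "0 < m" unfolding m_def by (rule expectation_random_weight_pos[OF w0])
  have B: "0 \<le> B" using y0(2) abs_ge_zero order_trans not_empty by blast
  have w0i: "integrable M w0" using w0 by (simp add: random_weight_def)
  note [measurable] = y0(1) borel_measurable_integrable[OF w0i]
  have wy0: "integrable M (\<lambda>x. w0 x * y0 x)"
    by (rule integrable_mult_bounded[OF w0i y0])
  have c_bound: "\<bar>c\<bar> \<le> B"
  proof -
    have "\<bar>expectation (\<lambda>x. w0 x * y0 x)\<bar> \<le> expectation (\<lambda>x. \<bar>w0 x * y0 x\<bar>)"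
      by (rule integral_abs_bound)
    also have "\<dots> \<le> expectation (\<lambda>x. w0 x * B)"
    proof (rule integral_mono_AE)
      have "AE x in M. 0 < w0 x" using w0 by (simp add: random_weight_def)
      then show "AE x in M. \<bar>w0 x * y0 x\<bar> \<le> w0 x * B"
        using AE_space by eventually_elim (auto simp: abs_mult y0(2))
    qed (use wy0 w0i in auto)
    finally show ?thesis using m w0i by (simp add: c_def m_def field_simps)
  qed
  have pairm: "random_variable borel (\<lambda>x. (w t x, y t x))" if "t \<ge> 1" for t
    using indep that by (simp add: indep_vars_def)
  have proj: "fst \<in> borel_measurable (borel :: (real \<times> real) measure)"
    "snd \<in> borel_measurable (borel :: (real \<times> real) measure)"
    by (intro borel_measurable_continuous_onI continuous_intros)+
  have ym: "random_variable borel (y t)" if "t \<ge> 1" for t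
    using measurable_compose[OF pairm[OF that] proj(2)] by simp
  have wm: "random_variable borel (w t)" if "t \<ge> 1" for t
    using measurable_compose[OF pairm[OF that] proj(1)] by simp
  \<comment> \<open>The law of large numbers for an arbitrary Borel function of the pairs. It is
    used for the weight itself and for the weight times the centred datum.\<close>
  have law: "(\<lambda>T. expectation (\<lambda>x. \<bar>(\<Sum>t=1..T. f (w t x, y t x)) / T - expectation (\<lambda>x. f (w0 x, y0 x))\<bar>)) \<longlonglongrightarrow> 0"
    if f[measurable]: "f \<in> borel_measurable borel" and int: "integrable M (\<lambda>x. f (w0 x, y0 x))"
    for f :: "real \<times> real \<Rightarrow> real"
  proof (rule weak_law_L1)
    show "indep_vars (\<lambda>_. borel) (\<lambda>t x. f (w t x, y t x)) {1..}"
      using indep by (rule indep_vars_compose2[where Y = "\<lambda>_. f"]) measurable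
    fix t :: nat assume t: "t \<ge> 1"
    have "distr M borel (\<lambda>x. f (w t x, y t x)) = distr (distr M borel (\<lambda>x. (w t x, y t x))) borel f"
      using pairm[OF t] by (simp add: distr_distr comp_def)
    also have "\<dots> = distr M borel (\<lambda>x. f (w0 x, y0 x))"
      unfolding distr[OF t] by (subst distr_distr) (auto simp: comp_def)
    finally show "distr M borel (\<lambda>x. f (w t x, y t x)) = distr M borel (\<lambda>x. f (w0 x, y0 x))" .
  qed (rule int)
  define W where "W T x = (\<Sum>t=1..T. w t x)" for T x
  define S where "S T x = (\<Sum>t=1..T. w t x * (y t x - c))" for T x
  have lawW: "(\<lambda>T. expectation (\<lambda>x. \<bar>W T x / T - m\<bar>)) \<longlonglongrightarrow> 0"
    using law[OF proj(1)] w0i by (simp add: W_def m_def)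
  have fS: "(\<lambda>p. fst p * (snd p - c)) \<in> borel_measurable (borel :: (real \<times> real) measure)"
    by (intro borel_measurable_continuous_onI continuous_intros)
  have "expectation (\<lambda>x. w0 x * (y0 x - c)) = 0"
    using wy0 w0i m by (simp add: right_diff_distrib c_def m_def)
  then have lawS: "(\<lambda>T. expectation (\<lambda>x. \<bar>S T x / T\<bar>)) \<longlonglongrightarrow> 0"
    using law[OF fS] wy0 w0i by (simp add: S_def right_diff_distrib)
  have bound: "\<bar>expectation (weighted_avg T w y) - c\<bar>
      \<le> (2 * B * expectation (\<lambda>x. \<bar>W T x / T - m\<bar>) + expectation (\<lambda>x. \<bar>S T x / T\<bar>)) / m"
    if T: "T \<ge> 1" for T :: nat
  proof -
    have [measurable]: "random_variable borel (w t)" "random_variable borel (y t)" if "t \<in> {1..T}" for t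
      using wm ym that by auto
    have Wi: "integrable M (W T)"
      unfolding W_def[abs_def] using w by (auto simp: random_weight_def)
    have Si: "integrable M (S T)"
    proof -
      have "integrable M (\<lambda>x. w t x * (y t x - c))" if t: "t \<in> {1..T}" for t
      proof (rule integrable_mult_bounded)
        show "integrable M (w t)" using w t by (auto simp: random_weight_def)
        show "random_variable borel (\<lambda>x. y t x - c)" using t by measurable
        show "\<bar>y t x - c\<bar> \<le> 2 * B" if "x \<in> space M" for x
          using y[of t x] c_bound t that by auto
      qed
      then show ?thesis unfolding S_def[abs_def] by auto
    qed
    have am[measurable]: "random_variable borel (weighted_avg T w y)"
      unfolding weighted_avg_def[abs_def] by measurable
    have pos: "AE x in M. \<forall>t\<in>{1..T}. 0 < w t x"
      using w by (intro AE_finite_allI) (auto simp: random_weight_def)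
    \<comment> \<open>The first bound makes the weighted average integrable; the second, once
      integrated, gives the rate.\<close>
    have pointwise: "AE x in M. \<bar>weighted_avg T w y x\<bar> \<le> B \<and>
      \<bar>weighted_avg T w y x - c\<bar> \<le> (2 * B * \<bar>W T x / T - m\<bar> + \<bar>S T x / T\<bar>) / m"
      using pos AE_space
    proof eventually_elim
      case (elim x)
      let ?a = "weighted_avg T w y x"
      have W: "0 < W T x" unfolding W_def using elim T by (intro sum_pos) auto
      have aW: "?a = (\<Sum>t=1..T. w t x * y t x) / W T x" by (simp add: weighted_avg_def W_def)
      have "\<bar>\<Sum>t=1..T. w t x * y t x\<bar> \<le> (\<Sum>t=1..T. \<bar>w t x * y t x\<bar>)" by (rule sum_abs)
      also have "\<dots> \<le> (\<Sum>t=1..T. w t x * B)"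
        using elim y by (intro sum_mono) (auto simp: abs_mult less_imp_le intro!: mult_mono)
      also have "\<dots> = B * W T x" by (simp add: W_def sum_distrib_left mult.commute)
      finally have a: "\<bar>?a\<bar> \<le> B" using W by (simp add: aW field_simps)
      have "S T x = (?a - c) * W T x"
      proof -
        have "S T x = (\<Sum>t=1..T. w t x * y t x) - W T x * c"
          by (simp add: S_def W_def right_diff_distrib sum_subtractf sum_distrib_right)
        moreover have "?a * W T x = (\<Sum>t=1..T. w t x * y t x)" using W by (simp add: aW)
        ultimately show ?thesis by (simp only: left_diff_distrib mult.commute[of c "W T x"])
      qed
      \<comment> \<open>Replacing the random \<open>W T x / T\<close> by \<open>m\<close> avoids
        dividing by a sum of weights that may be close to 0.\<close>
      then have "(?a - c) * m = S T x / T - (?a - c) * (W T x / T - m)"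
        by (simp add: field_simps)
      then have "\<bar>?a - c\<bar> * m \<le> \<bar>S T x / T\<bar> + \<bar>?a - c\<bar> * \<bar>W T x / T - m\<bar>"
        using m by (metis abs_mult abs_of_pos abs_triangle_ineq4)
      also have "\<bar>?a - c\<bar> * \<bar>W T x / T - m\<bar> \<le> 2 * B * \<bar>W T x / T - m\<bar>"
        using a c_bound by (intro mult_right_mono) auto
      finally show ?case using m a by (simp add: field_simps)
    qed
    have ai: "integrable M (weighted_avg T w y)"
      using pointwise by (intro integrable_const_bound[where B = B]) auto
    have "\<bar>expectation (weighted_avg T w y) - c\<bar> = \<bar>expectation (\<lambda>x. weighted_avg T w y x - c)\<bar>"
      using ai by (simp add: prob_space)
    also have "\<dots> \<le> expectation (\<lambda>x. \<bar>weighted_avg T w y x - c\<bar>)"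
      by (rule integral_abs_bound)
    also have "\<dots> \<le> expectation (\<lambda>x. (2 * B * \<bar>W T x / T - m\<bar> + \<bar>S T x / T\<bar>) / m)"
      using pointwise ai Wi Si by (intro integral_mono_AE) auto
    also have "\<dots> = (2 * B * expectation (\<lambda>x. \<bar>W T x / T - m\<bar>) + expectation (\<lambda>x. \<bar>S T x / T\<bar>)) / m"
      using Wi Si by simp
    finally show ?thesis .
  qed
  have "(\<lambda>T. expectation (weighted_avg T w y) - c) \<longlonglongrightarrow> 0"
  proof (rule Lim_null_comparison)
    show "eventually (\<lambda>T. norm (expectation (weighted_avg T w y) - c)
        \<le> (2 * B * expectation (\<lambda>x. \<bar>W T x / T - m\<bar>) + expectation (\<lambda>x. \<bar>S T x / T\<bar>)) / m) sequentially"
      using bound by (auto intro: eventually_sequentiallyI[of 1])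
    have "(\<lambda>T. (2 * B * expectation (\<lambda>x. \<bar>W T x / T - m\<bar>) + expectation (\<lambda>x. \<bar>S T x / T\<bar>)) / m)
        \<longlonglongrightarrow> (2 * B * 0 + 0) / m"
      using m by (intro tendsto_intros lawW lawS) auto
    then show "(\<lambda>T. (2 * B * expectation (\<lambda>x. \<bar>W T x / T - m\<bar>) + expectation (\<lambda>x. \<bar>S T x / T\<bar>)) / m)
        \<longlonglongrightarrow> 0" by simp
  qed
  then show ?thesis
    unfolding c_def m_def by (rule LIM_zero_cancel)
qed

end

section \<open>A biased weighted average\<close>

text \<open>One fair chance move. The public information separates the root (value 2) from the two
  outcomes, so every private class is a singleton.\<close>

definition coin_game :: "(nat, nat, nat) efg" where
  "coin_game = \<lparr>players = {0}, chance = 0, histories = {[], [0], [1]}, player = (\<lambda>_. 0),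
     chance_prob = (\<lambda>_. pmf_of_set {0, 1}), public_info = (\<lambda>h. if h = [] then 2 else hd h),
     private_info = (\<lambda>_ _. 0)\<rparr>"

lemma actions_coin_game: "actions coin_game h = (if h = [] then {0, 1} else {})"
  by (auto simp: actions_def coin_game_def)

lemma terminals_coin_game: "terminals coin_game = {[0], [1]}"
  unfolding terminals_def actions_coin_game by (auto simp: coin_game_def)

lemma private_class_coin_game: "h \<in> histories coin_game \<Longrightarrow> private_class coin_game h = {h}"
  by (auto simp: private_class_def coin_game_def)

lemma extensive_form_game_coin_game: "extensive_form_game coin_game"
proof
  show "set_pmf (chance_prob coin_game h) \<subseteq> actions coin_game h"
    if "h \<in> nonterminals coin_game" for h
    using that unfolding nonterminals_def terminals_coin_game actions_coin_game
    by (auto simp: coin_game_def)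
  show "player coin_game h' = player coin_game h"
    if "h \<in> histories coin_game" "h' \<in> private_class coin_game h" for h h'
    by (simp add: coin_game_def)
  show "actions coin_game h' = actions coin_game h"
    if "h \<in> histories coin_game" "h' \<in> private_class coin_game h" for h h'
    using that private_class_coin_game by simp
qed (auto simp: coin_game_def)

lemma reach_coin_game: "z \<in> terminals coin_game \<Longrightarrow> reach coin_game \<sigma> z = 1 / 2"
  unfolding terminals_coin_game reach_def action_dist_def by (auto simp: coin_game_def)

text \<open>The class of \<open>z\<close> is a singleton of reach probability 1/2, so the base term
  is \<open>v z\<close>; with no known histories the correction is an empty sum.\<close>

lemma aivat_coin_game: "z \<in> terminals coin_game \<Longrightarrow> aivat coin_game \<sigma> {} v v' z = v z"
  by (simp add: aivat_def aivat_base_def aivat_correction_def known_steps_def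
      private_class_coin_game reach_coin_game terminals_def[of coin_game])

text \<open>The sample space consists of the two binary digits of a uniform number below 4; digit \<open>t - 1\<close>
  is the outcome of trial \<open>t\<close>, and the first weight doubles exactly when the first outcome is 1.\<close>

definition two_flips :: "nat pmf" where
  "two_flips = pmf_of_set {0, 1, 2, 3}"

definition flip_history :: "nat \<Rightarrow> nat \<Rightarrow> nat list" where
  "flip_history t x = [if t = 1 then x mod 2 else x div 2 mod 2]"

definition flip_weight :: "nat \<Rightarrow> nat \<Rightarrow> real" where
  "flip_weight t x = (if t = 1 then 1 + real (x mod 2) else 1)"

section \<open>Law and independence of the two flips\<close>

lemma flip_history_terminals: "flip_history t x \<in> terminals coin_game"
  by (auto simp: flip_history_def terminals_coin_game)

lemma expectation_two_flips:
  fixes f :: "nat \<Rightarrow> real"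
  shows "measure_pmf.expectation two_flips f = (f 0 + f 1 + f 2 + f 3) / 4"
  unfolding two_flips_def by (subst integral_pmf_of_set) (auto simp: add_ac)

lemma integrable_two_flips:
  fixes f :: "nat \<Rightarrow> real"
  shows "integrable (measure_pmf two_flips) f"
  by (rule integrable_measure_pmf_finite) (simp add: two_flips_def)

lemma prob_two_flips:
  "measure_pmf.prob two_flips A = (indicator A 0 + indicator A 1 + indicator A 2 + indicator A 3) / 4"
  using expectation_two_flips[of "indicator A"] by simp

lemma measurable_flip_history:
  "flip_history t \<in> measurable (measure_pmf two_flips) (count_space (terminals coin_game))"
  using flip_history_terminals by simp

text \<open>On a finite space it is enough to compare singletons, and each outcome of a digit occurs
  at two of the four sample points.\<close>

lemma random_terminal_flip_history:
  "random_terminal (measure_pmf two_flips) coin_game \<sigma> (flip_history t)"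
  unfolding random_terminal_def distributed_def
proof (intro conjI measurable_flip_history)
  let ?N = "count_space (terminals coin_game)"
  show "distr (measure_pmf two_flips) ?N (flip_history t)
      = density ?N (\<lambda>\<zeta>. ennreal (reach coin_game \<sigma> \<zeta>))"
  proof (rule measure_eqI_finite[of _ "terminals coin_game"])
    fix a assume a: "a \<in> terminals coin_game"
    have "emeasure (distr (measure_pmf two_flips) ?N (flip_history t)) {a}
        = ennreal (measure_pmf.prob two_flips (flip_history t -` {a}))"
      using a measurable_flip_history by (simp add: emeasure_distr measure_pmf.emeasure_eq_measure)
    also have "measure_pmf.prob two_flips (flip_history t -` {a}) = 1 / 2"
      using a unfolding prob_two_flips
      by (auto simp: terminals_coin_game flip_history_def indicator_def)
    also have "ennreal (1 / 2) = emeasure (density ?N (\<lambda>\<zeta>. ennreal (reach coin_game \<sigma> \<zeta>))) {a}"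
      using a by (auto simp: emeasure_density reach_coin_game nn_integral_count_space_finite
          terminals_coin_game)
    finally show "emeasure (distr (measure_pmf two_flips) ?N (flip_history t)) {a}
        = emeasure (density ?N (\<lambda>\<zeta>. ennreal (reach coin_game \<sigma> \<zeta>))) {a}" .
  qed (auto simp: terminals_coin_game)
qed simp

lemma indep_flip_history:
  "prob_space.indep_vars (measure_pmf two_flips) (\<lambda>_. count_space (terminals coin_game))
     flip_history {1..2}"
proof -
  have I: "{1..2} = {1, 2 :: nat}" by auto
  \<comment> \<open>The product formula is verified for arbitrary events by evaluating both sides at
    the four sample points.\<close>
  have "measure_pmf.prob two_flips (\<Inter>j\<in>{1, 2}. flip_history j -` A j \<inter> UNIV)
      = (\<Prod>j\<in>{1, 2}. measure_pmf.prob two_flips (flip_history j -` A j \<inter> UNIV))" for A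
    unfolding prob_two_flips by (simp add: flip_history_def indicator_def)
  then show ?thesis
    unfolding I
    by (subst prob_space.indep_vars_finite[where E = "\<lambda>_. Pow (terminals coin_game)",
          OF measure_pmf.prob_space_axioms])
      (auto simp: Int_stable_def sets.sigma_sets_eq[of "count_space _", simplified]
        flip_history_terminals)
qed

lemma weighted_trials_two_flips:
  "weighted_trials (measure_pmf two_flips) coin_game \<sigma> {1..2} flip_history flip_weight"
  unfolding weighted_trials_def
  by (auto simp: indep_flip_history[simplified] random_terminal_flip_history random_weight_def
      integrable_two_flips measure_pmf.prob_space_axioms flip_weight_def)

lemma weighted_avg_biased:
  "\<exists>(G :: (nat, nat, nat) efg) \<sigma> D v v' (M :: nat measure) z w T.
    extensive_form_game G \<and> strategy_profile G \<sigma> \<and> known_histories G D \<and> T \<ge> 1 \<and>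
    weighted_trials M G \<sigma> {1..T} z w \<and>
    (\<exists>s\<in>{1..T}. \<exists>t\<in>{1..T}. covariance M (w s) (\<lambda>x. aivat G \<sigma> D v v' (z t x)) \<noteq> 0) \<and>
    prob_space.expectation M (weighted_avg T w (\<lambda>t x. aivat G \<sigma> D v v' (z t x)))
      \<noteq> terminal_expectation G \<sigma> v"
proof (intro exI conjI)
  define v where "v z = real (hd z)" for z :: "nat list"
  \<comment> \<open>Chance is the only player, so this profile is a mere filler.\<close>
  define \<sigma> :: "nat \<Rightarrow> nat list \<Rightarrow> nat pmf" where "\<sigma> = (\<lambda>_ _. return_pmf 0)"
  have I: "{1..2} = {1, 2 :: nat}" by auto
  have aivat: "aivat coin_game \<sigma> {} v v (flip_history t x) = real (hd (flip_history t x))" for t x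
    by (simp add: aivat_coin_game flip_history_terminals v_def)
  show "extensive_form_game coin_game" by (rule extensive_form_game_coin_game)
  show "strategy_profile coin_game \<sigma>" by (simp add: strategy_profile_def coin_game_def)
  show "known_histories coin_game {}" by (simp add: known_histories_def)
  show "(2 :: nat) \<ge> 1" by simp
  show "weighted_trials (measure_pmf two_flips) coin_game \<sigma> {1..2} flip_history flip_weight"
    by (rule weighted_trials_two_flips)
  \<comment> \<open>Both witnesses are trial 1, whose weight is 1 plus its outcome; the covariance
    is the variance 1/4 of a fair bit.\<close>
  show "\<exists>s\<in>{1..2}. \<exists>t\<in>{1..2}. covariance (measure_pmf two_flips) (flip_weight s)
      (\<lambda>x. aivat coin_game \<sigma> {} v v (flip_history t x)) \<noteq> 0"
    unfolding aivat covariance_def expectation_two_flips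
    by (intro bexI[of _ 1]) (auto simp: flip_weight_def flip_history_def)
  \<comment> \<open>The weighted averages at the sample points 0, 1, 2, 3 are 0, 2/3, 1/2, 1, with
    mean 13/24, while the expected value of \<open>v\<close> is 1/2.\<close>
  show "measure_pmf.expectation two_flips
      (weighted_avg 2 flip_weight (\<lambda>t x. aivat coin_game \<sigma> {} v v (flip_history t x)))
    \<noteq> terminal_expectation coin_game \<sigma> v"
    unfolding aivat weighted_avg_def I expectation_two_flips terminal_expectation_def
    by (simp add: flip_weight_def flip_history_def reach_coin_game terminals_coin_game v_def)
qed

section \<open>Bias of the weighted average\<close>

text \<open>In the third part the pair \<open>w\<^sub>0\<close>, \<open>z\<^sub>0\<close> carries
  the common law of the data points. The joint laws of weight and estimate are equated, since the
  covariance depends on the joint law.\<close>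

theorem proposition3:
  shows
    "(\<forall>(G :: ('p, 'a, 'i) efg) \<sigma> D v v' (M :: 'm measure) z w T.
        extensive_form_game G \<and> strategy_profile G \<sigma> \<and> known_histories G D \<and> T \<ge> 1 \<and>
        weighted_trials M G \<sigma> {1..T} z w \<and>
        prob_space.indep_var M
          (Pi\<^sub>M {1..T} (\<lambda>_. borel)) (\<lambda>x. \<lambda>t\<in>{1..T}. w t x)
          (Pi\<^sub>M {1..T} (\<lambda>_. borel)) (\<lambda>x. \<lambda>t\<in>{1..T}. aivat G \<sigma> D v v' (z t x))
        \<longrightarrow> prob_space.expectation M (weighted_avg T w (\<lambda>t x. aivat G \<sigma> D v v' (z t x)))
              = terminal_expectation G \<sigma> v)
     \<and>
     (\<exists>(G :: (nat, nat, nat) efg) \<sigma> D v v' (M :: nat measure) z w T.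
        extensive_form_game G \<and> strategy_profile G \<sigma> \<and> known_histories G D \<and> T \<ge> 1 \<and>
        weighted_trials M G \<sigma> {1..T} z w \<and>
        (\<exists>s\<in>{1..T}. \<exists>t\<in>{1..T}. covariance M (w s) (\<lambda>x. aivat G \<sigma> D v v' (z t x)) \<noteq> 0) \<and>
        prob_space.expectation M (weighted_avg T w (\<lambda>t x. aivat G \<sigma> D v v' (z t x)))
          \<noteq> terminal_expectation G \<sigma> v)
     \<and>
     (\<forall>(G :: ('p, 'a, 'i) efg) \<sigma> D v v' (M :: 'm measure) z w z\<^sub>0 w\<^sub>0.
        extensive_form_game G \<and> strategy_profile G \<sigma> \<and> known_histories G D \<and>
        weighted_trials M G \<sigma> {1..} z w \<and>
        random_terminal M G \<sigma> z\<^sub>0 \<and> random_weight M w\<^sub>0 \<and>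
        prob_space.indep_vars M (\<lambda>_. borel) (\<lambda>t x. (w t x, aivat G \<sigma> D v v' (z t x))) {1..} \<and>
        (\<forall>t\<ge>1. distr M borel (\<lambda>x. (w t x, aivat G \<sigma> D v v' (z t x)))
                = distr M borel (\<lambda>x. (w\<^sub>0 x, aivat G \<sigma> D v v' (z\<^sub>0 x))))
        \<longrightarrow> (\<lambda>T. prob_space.expectation M (weighted_avg T w (\<lambda>t x. aivat G \<sigma> D v v' (z t x)))
                   - terminal_expectation G \<sigma> v)
            \<longlonglongrightarrow> covariance M w\<^sub>0 (\<lambda>x. aivat G \<sigma> D v v' (z\<^sub>0 x)) / prob_space.expectation M w\<^sub>0)"
proof (intro conjI allI impI weighted_avg_biased; elim conjE)
  fix G :: "('p, 'a, 'i) efg" and \<sigma> D v v' and M :: "'m measure"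
    and z :: "nat \<Rightarrow> 'm \<Rightarrow> 'a list" and w and T :: nat
  let ?y = "\<lambda>t x. aivat G \<sigma> D v v' (z t x)"
  assume game: "extensive_form_game G" "strategy_profile G \<sigma>" "known_histories G D"
    and T: "T \<ge> 1"
    and trials: "weighted_trials M G \<sigma> {1..T} z w"
    and indep: "prob_space.indep_var M
      (Pi\<^sub>M {1..T} (\<lambda>_. borel)) (\<lambda>x. \<lambda>t\<in>{1..T}. w t x)
      (Pi\<^sub>M {1..T} (\<lambda>_. borel)) (\<lambda>x. \<lambda>t\<in>{1..T}. ?y t x)"
  interpret G: extensive_form_game G by (rule game)
  interpret prob_space M using trials by (simp add: weighted_trials_def)
  have z: "random_terminal M G \<sigma> (z t)" if "t \<in> {1..T}" for t
    using trials that by (simp add: weighted_trials_def)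
  show "expectation (weighted_avg T w ?y) = terminal_expectation G \<sigma> v"
  proof (rule expectation_weighted_avg_indep[OF T _ _ _ indep])
    fix t assume t: "t \<in> {1..T}"
    show "random_weight M (w t)" using trials t by (simp add: weighted_trials_def)
    show "integrable M (?y t)"
      by (rule random_terminal_compose[OF G.finite_terminals z[OF t]])
        (rule integrable_const_bound, auto)
    show "expectation (?y t) = terminal_expectation G \<sigma> v"
      using expectation_random_terminal[OF G.finite_terminals z[OF t]]
        G.expectation_aivat[OF game(2,3)] by simp
  qed
next
  fix G :: "('p, 'a, 'i) efg" and \<sigma> D v v' and M :: "'m measure"
    and z :: "nat \<Rightarrow> 'm \<Rightarrow> 'a list" and w z\<^sub>0 w\<^sub>0
  let ?f = "aivat G \<sigma> D v v'"
  assume game: "extensive_form_game G" "strategy_profile G \<sigma>" "known_histories G D"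
    and trials: "weighted_trials M G \<sigma> {1..} z w"
    and z\<^sub>0: "random_terminal M G \<sigma> z\<^sub>0" and w\<^sub>0: "random_weight M w\<^sub>0"
    and indep: "prob_space.indep_vars M (\<lambda>_. borel) (\<lambda>t x. (w t x, ?f (z t x))) {1..}"
    and distr: "\<forall>t\<ge>1. distr M borel (\<lambda>x. (w t x, ?f (z t x))) = distr M borel (\<lambda>x. (w\<^sub>0 x, ?f (z\<^sub>0 x)))"
  interpret G: extensive_form_game G by (rule game)
  interpret prob_space M using trials by (simp add: weighted_trials_def)
  obtain B where y0: "random_variable borel (\<lambda>x. ?f (z\<^sub>0 x))" "\<And>x. x \<in> space M \<Longrightarrow> \<bar>?f (z\<^sub>0 x)\<bar> \<le> B"
    and B: "\<And>\<zeta>. \<zeta> \<in> terminals G \<Longrightarrow> \<bar>?f \<zeta>\<bar> \<le> B"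
    using random_terminal_compose[OF G.finite_terminals z\<^sub>0, of ?f] by metis
  have y: "\<bar>?f (z t x)\<bar> \<le> B" if "t \<ge> 1" "x \<in> space M" for t x
  proof (rule B)
    have zt: "z t \<in> measurable M (count_space (terminals G))"
      using trials that by (simp add: weighted_trials_def random_terminal_def distributed_def)
    show "z t x \<in> terminals G"
      using measurable_space[OF zt that(2)] by simp
  qed
  have limit: "(\<lambda>T. expectation (weighted_avg T w (\<lambda>t x. ?f (z t x))))
      \<longlonglongrightarrow> expectation (\<lambda>x. w\<^sub>0 x * ?f (z\<^sub>0 x)) / expectation w\<^sub>0"
    by (rule weighted_avg_expectation_limit[OF _ y w\<^sub>0 y0 indep])
      (use trials distr in \<open>auto simp: weighted_trials_def\<close>)
  have mean: "expectation (\<lambda>x. ?f (z\<^sub>0 x)) = terminal_expectation G \<sigma> v"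
    using expectation_random_terminal[OF G.finite_terminals z\<^sub>0]
      G.expectation_aivat[OF game(2,3)] by simp
  have w0i: "integrable M w\<^sub>0" using w\<^sub>0 by (simp add: random_weight_def)
  have y0i: "integrable M (\<lambda>x. ?f (z\<^sub>0 x))"
    using y0 by (intro integrable_const_bound[where B = B]) auto
  have "covariance M w\<^sub>0 (\<lambda>x. ?f (z\<^sub>0 x))
      = expectation (\<lambda>x. w\<^sub>0 x * ?f (z\<^sub>0 x)) - expectation w\<^sub>0 * terminal_expectation G \<sigma> v"
    using covariance_eq[OF w0i y0i integrable_mult_bounded[OF w0i y0]] mean by simp
  \<comment> \<open>The mean of the estimate is that of \<open>v\<close> by unbiasedness, so
    dividing the covariance by the mean weight gives the limit of the weighted average minus the
    target.\<close>
  then have "covariance M w\<^sub>0 (\<lambda>x. ?f (z\<^sub>0 x)) / expectation w\<^sub>0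
      = expectation (\<lambda>x. w\<^sub>0 x * ?f (z\<^sub>0 x)) / expectation w\<^sub>0 - terminal_expectation G \<sigma> v"
    using expectation_random_weight_pos[OF w\<^sub>0] by (simp add: field_simps)
  then show "(\<lambda>T. expectation (weighted_avg T w (\<lambda>t x. ?f (z t x))) - terminal_expectation G \<sigma> v)
      \<longlonglongrightarrow> covariance M w\<^sub>0 (\<lambda>x. ?f (z\<^sub>0 x)) / expectation w\<^sub>0"
    using tendsto_diff[OF limit tendsto_const] by simp
qed

end
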